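(* For all integers $l\geq 2$ and $m\geq 2l-1$, $$A(m,l-1)\leq c_{m+1,\,m-2l+1}\,A(m,l),$$ where $$c_{n,r}=\frac{(n-r-2)(n-r)(n-r+2)}{(n+r)(n+r+2)(n+r+4)}.$$
   Context: $A(m,l)$ denotes the Eulerian numbers of the first kind, defined recursively for integers $m,l\ge 0$ by $A(0,0)=1$, $A(m,0)=0$ for $m>0$, $A(0,l)=0$ for $l>0$, and $$A(m,l)=(m-l+1)A(m-1,l-1)+l\,A(m-1,l)\quad\text{for } m>0,\ l>0.$$ *)

theory Defs
  imports Complex_Main
begin

text \<open>Eulerian numbers of the first kind, in the indexing where, for \<open>m > 0\<close>,
  the nonzero values are those with \<open>1 \<le> l \<le> m\<close>. In the last equation \<open>m + 1\<close> and \<open>l + 1\<close>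
  replace \<open>m\<close> and \<open>l\<close>, so the coefficient \<open>m - l + 1\<close> keeps its form; it is an integer
  because it may be negative.\<close>

fun eulerian :: "nat \<Rightarrow> nat \<Rightarrow> int" where
  "eulerian 0 0 = 1"
| "eulerian (Suc m) 0 = 0"
| "eulerian 0 (Suc l) = 0"
| "eulerian (Suc m) (Suc l) =
    (int (Suc m) - int (Suc l) + 1) * eulerian m l + int (Suc l) * eulerian m (Suc l)"

definition c :: "int \<Rightarrow> int \<Rightarrow> real" where
  "c n r = of_int ((n - r - 2) * (n - r) * (n - r + 2)) /
           of_int ((n + r) * (n + r + 2) * (n + r + 4))"

end

theory Submission
  imports Defs
begin

text \<open>Clearing denominators, the claim reads
  \<open>A m j * ((m-j) (m-j+1) (m-j+2)) \<le> j (j+1) (j+2) * A m (j+1)\<close> with \<open>j = l - 1\<close>, which makes sense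
  for \<open>j = 0\<close> too. It is proved by induction on \<open>m\<close>: after the recurrence is expanded and the
  induction hypothesis is applied to two neighbouring values of \<open>j\<close>, the slack is a nonnegative
  multiple of \<open>d\<^sup>3 - d\<close> for an integer \<open>d \<ge> 1\<close>. The only case in which the hypothesis is not
  available is at the centre of an even row, where \<open>d = 1\<close> and the symmetry of the row gives an
  equality of the two central terms instead.\<close>

lemma eulerian_Suc_Suc:
  "eulerian (Suc m) (Suc l) = (int m - int l + 1) * eulerian m l + (int l + 1) * eulerian m (Suc l)"
  by (simp add: add.commute)

declare eulerian.simps(4) [simp del]

lemma eulerian_eq_0: "m < l \<Longrightarrow> eulerian m l = 0"
  by (induction m l rule: eulerian.induct) (auto simp: eulerian_Suc_Suc)

lemma eulerian_nonneg: "0 \<le> eulerian m l"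
proof (induction m l rule: eulerian.induct)
  case (4 m l)
  then show ?case
    \<comment> \<open>For \<open>l > m\<close> the coefficient of \<open>eulerian m l\<close> is
      zero or negative, but that entry vanishes.\<close>
    by (cases "l \<le> m") (simp_all add: eulerian_eq_0 eulerian_Suc_Suc)
qed auto

text \<open>Reversing a row swaps the two terms of the recurrence together with their coefficients.
  The end columns are separate because one of their two terms vanishes.\<close>

lemma eulerian_symmetric:
  "a + b = m \<Longrightarrow> eulerian (Suc m) (Suc a) = eulerian (Suc m) (Suc b)"
proof (induction m arbitrary: a b)
  case 0
  then show ?case by simp
next
  case (Suc m)
  have rec: "eulerian (Suc (Suc m)) (Suc (Suc i))
      = (int j + 1) * eulerian (Suc m) (Suc i) + (int i + 2) * eulerian (Suc m) (Suc (Suc i))"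
    if "i + j = m" for i j
    using that eulerian_Suc_Suc[of "Suc m" "Suc i"] by auto
  have first: "eulerian (Suc (Suc m)) (Suc 0) = eulerian (Suc m) (Suc 0)"
    by (simp add: eulerian_Suc_Suc[of "Suc m"])
  have last: "eulerian (Suc (Suc m)) (Suc (Suc m)) = eulerian (Suc m) (Suc m)"
    using rec[of m 0] by (simp add: eulerian_eq_0)
  show ?case
  proof (cases a)
    case 0
    with Suc.prems show ?thesis
      using first last Suc.IH[of 0 m] by simp
  next
    case a: (Suc i)
    show ?thesis
    proof (cases b)
      case 0
      with Suc.prems show ?thesis
        using first last Suc.IH[of 0 m] by simp
    next
      case b: (Suc j)
      have "eulerian (Suc m) (Suc i) = eulerian (Suc m) (Suc (Suc j))"
        and "eulerian (Suc m) (Suc (Suc i)) = eulerian (Suc m) (Suc j)"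
        using Suc.IH[of i "Suc j"] Suc.IH[of "Suc i" j] Suc.prems a b by simp_all
      then show ?thesis
        using rec[of i "Suc j"] rec[of j "Suc i"] Suc.prems a b
        by (simp add: add.commute)
    qed
  qed
qed

text \<open>The algebraic core of the induction: \<open>X\<close>, \<open>Y\<close>,
  \<open>Z\<close> stand for the entries of row \<open>m\<close> in columns \<open>i\<close>,
  \<open>i + 1\<close>, \<open>i + 2\<close>, and \<open>k\<close> for \<open>m - i\<close>. The
  conclusion compares columns \<open>i + 1\<close> and \<open>i + 2\<close> of the next row.\<close>

lemma ratio_step:
  fixes X Y Z k i :: int
  assumes "0 \<le> i" "0 \<le> Y" "i + 2 \<le> k"
    and X: "X * (k * (k + 1) * (k + 2)) \<le> i * (i + 1) * (i + 2) * Y"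
    and Z: "Y * ((k - 1) * k * (k + 1)) \<le> (i + 1) * (i + 2) * (i + 3) * Z"
  shows "((k + 1) * X + (i + 1) * Y) * (k * (k + 1) * (k + 2))
    \<le> (i + 1) * (i + 2) * (i + 3) * (k * Y + (i + 2) * Z)"
proof -
  define d where "d = k - i - 1"
  have "1 \<le> d"
    using assms by (simp add: d_def)
  then have d: "0 \<le> (d - 1) * d * (d + 1)"
    by simp
  have "(k + 1) * (X * (k * (k + 1) * (k + 2))) \<le> (k + 1) * (i * (i + 1) * (i + 2) * Y)"
    using X assms by (intro mult_left_mono) auto
  moreover have "(i + 2) * (Y * ((k - 1) * k * (k + 1)))
      \<le> (i + 2) * ((i + 1) * (i + 2) * (i + 3) * Z)"
    using Z assms by (intro mult_left_mono) auto
  moreover have "0 \<le> Y * ((d - 1) * d * (d + 1))"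
    using \<open>0 \<le> Y\<close> d by simp
  \<comment> \<open>Once \<open>X\<close> and \<open>Z\<close> are bounded through \<open>Y\<close>,
    only multiples of \<open>Y\<close> remain, and their difference factors.\<close>
  moreover have "(i + 1) * (i + 2) * (i + 3) * (k * Y) + (i + 2) * (Y * ((k - 1) * k * (k + 1)))
      - (k + 1) * (i * (i + 1) * (i + 2) * Y) - (i + 1) * Y * (k * (k + 1) * (k + 2))
      = Y * ((d - 1) * d * (d + 1))"
    unfolding d_def by algebra
  ultimately show ?thesis
    by (simp add: algebra_simps)
qed

lemma eulerian_ratio:
  "2 * j + 1 \<le> m \<Longrightarrow>
    eulerian m j * ((int m - int j) * (int m - int j + 1) * (int m - int j + 2))
      \<le> int j * (int j + 1) * (int j + 2) * eulerian m (Suc j)"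
proof (induction m arbitrary: j)
  case 0
  then show ?case by simp
next
  case (Suc m)
  show ?case
  proof (cases j)
    \<comment> \<open>Both sides are zero. Admitting column 0 lets the step for \<open>j = 1\<close>
      use the hypothesis at \<open>i = 0\<close>.\<close>
    case 0
    then show ?thesis by simp
  next
    case j: (Suc i)
    define k where "k = int m - int i"
    have "eulerian m (Suc i) * ((k - 1) * k * (k + 1))
        \<le> (int i + 1) * (int i + 2) * (int i + 3) * eulerian m (Suc (Suc i))"
    proof (cases "2 * Suc i + 1 \<le> m")
      case True
      from Suc.IH[OF this] show ?thesis
        by (simp add: k_def algebra_simps)
    next
      \<comment> \<open>The premise gives \<open>2 * i + 2 \<le> m\<close>, one less than the
        hypothesis at \<open>Suc i\<close> needs, so equality holds here.\<close>
      case False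
      then have m: "m = Suc (i + Suc i)"
        using Suc.prems j by simp
      have "eulerian m (Suc i) = eulerian m (Suc (Suc i))"
        unfolding m by (rule eulerian_symmetric) simp
      \<comment> \<open>With this value the cubic factors on the two sides coincide.\<close>
      moreover have "k = int i + 2"
        using m by (simp add: k_def)
      ultimately show ?thesis
        by (simp add: algebra_simps)
    qed
    moreover have "eulerian m i * (k * (k + 1) * (k + 2))
        \<le> int i * (int i + 1) * (int i + 2) * eulerian m (Suc i)"
      using Suc.IH[of i] Suc.prems j by (simp add: k_def algebra_simps)
    moreover have "int i + 2 \<le> k"
      using Suc.prems j by (simp add: k_def)
    ultimately have "((k + 1) * eulerian m i + (int i + 1) * eulerian m (Suc i))
          * (k * (k + 1) * (k + 2))
        \<le> (int i + 1) * (int i + 2) * (int i + 3)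
          * (k * eulerian m (Suc i) + (int i + 2) * eulerian m (Suc (Suc i)))"
      by (intro ratio_step[OF _ eulerian_nonneg]) auto
    moreover have "eulerian (Suc m) (Suc i)
        = (k + 1) * eulerian m i + (int i + 1) * eulerian m (Suc i)"
      by (simp add: eulerian_Suc_Suc k_def)
    moreover have "eulerian (Suc m) (Suc (Suc i))
        = k * eulerian m (Suc i) + (int i + 2) * eulerian m (Suc (Suc i))"
      by (simp add: eulerian_Suc_Suc k_def)
    moreover have "int (Suc m) - int j = k" "int j = int i + 1"
      using j by (simp_all add: k_def)
    ultimately show ?thesis
      using j by (simp add: ac_simps)
  qed
qed

theorem proposition3p1:
  fixes l m :: nat
  assumes "l \<ge> 2" and "int m \<ge> 2 * int l - 1"
  shows "real_of_int (eulerian m (l - 1))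
    \<le> c (int m + 1) (int m - 2 * int l + 1) * real_of_int (eulerian m l)"
proof -
  obtain j where l: "l = Suc j"
    using assms by (cases l) auto
  define p where "p = int m - int j"
  define N where "N = int j * (int j + 1) * (int j + 2)"
  define D where "D = p * (p + 1) * (p + 2)"
  have "0 < p"
    using assms l by (simp add: p_def)
  then have "0 < D"
    by (simp add: D_def)
  have "eulerian m j * D \<le> N * eulerian m l"
    using eulerian_ratio[of j m] assms l by (simp add: D_def N_def p_def)
  then have "real_of_int (eulerian m j) * D \<le> N * real_of_int (eulerian m l)"
    by (metis of_int_le_iff of_int_mult)
  then have "real_of_int (eulerian m j) \<le> N * real_of_int (eulerian m l) / D"
    using \<open>0 < D\<close> by (simp add: pos_le_divide_eq)
  \<comment> \<open>With \<open>n = m + 1\<close> and \<open>r = m - 2 * l + 1\<close>,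
    \<open>n + r = 2 * p\<close> and \<open>n - r = 2 * l\<close>, so each of the three factors
    above and below contributes a 2.\<close>
  moreover have "c (int m + 1) (int m - 2 * int l + 1) = of_int (8 * N) / of_int (8 * D)"
  proof -
    have "(2 * int l - 2) * (2 * int l) * (2 * int l + 2) = 8 * N"
      unfolding N_def l by (simp add: algebra_simps)
    moreover have "(2 * p) * (2 * p + 2) * (2 * p + 4) = 8 * D"
      unfolding D_def by (simp add: algebra_simps)
    moreover have "int m + 1 + (int m - 2 * int l + 1) = 2 * p"
        "int m + 1 - (int m - 2 * int l + 1) = 2 * int l"
      by (simp_all add: p_def l)
    ultimately show ?thesis
      unfolding c_def by (simp only: mult.assoc)
  qed
  ultimately show ?thesis
    using l by simp
qed

end
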